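(* Let $(T,\vdash,\dashv,\perp)$ be a triassociative algebra and suppose that the associative algebra $(T,\perp)$ is nilpotent of class $n$. Then the associative algebras $(T,\vdash)$ and $(T,\dashv)$ are nilpotent of class less than or equal to $n+1$.
   Context: A triassociative algebra $(T,\vdash,\dashv,\perp)$ is a vector space $T$ over a field with three bilinear products $\vdash,\dashv,\perp:T\times T\to T$ satisfying, for all $x,y,z\in T$: (A1) $(x\vdash y)\vdash z=x\vdash(y\vdash z)$; (A2) $(x\dashv y)\dashv z=x\dashv(y\dashv z)$; (D1) $(x\dashv y)\vdash z=x\vdash(y\vdash z)$; (D2) $(x\dashv y)\dashv z=x\dashv(y\vdash z)$; (S1) $(x\vdash y)\dashv z=x\vdash(y\dashv z)$; (T1) $(x\perp y)\vdash z=x\vdash(y\vdash z)$; (T2) $(x\dashv y)\dashv z=x\dashv(y\perp z)$; (T3) $(x\vdash y)\perp z=x\vdash(y\perp z)$; (T4) $(x\perp y)\dashv z=x\perp(y\dashv z)$; (S2) $(x\dashv y)\perp z=x\perp(y\vdash z)$; (A3) $(x\perp y)\perp z=x\perp(y\perp z)$. In particular $(T,\vdash)$, $(T,\dashv)$, $(T,\perp)$ are (not necessarily unital) associative algebras. For an associative algebra $A$, $A^n$ denotes the ideal generated by all $n$-fold products of elements of $A$ ($A^1=A$). $A$ is nilpotent if $A^n=0$ for some $n\in\mathbb{N}$, and nilpotent of class $n$ if $A^n\neq 0$ and $A^{n+1}=0$. Thus being nilpotent of class less than or equal to $n+1$ means that all $(n+2)$-fold products vanish. *)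

theory Defs
  imports Complex_Main
begin

locale associative_algebra = vector_space scale
  for scale :: "'k::field \<Rightarrow> 'a::ab_group_add \<Rightarrow> 'a" (infixr \<open>*s\<close> 75) +
  fixes mult :: "'a \<Rightarrow> 'a \<Rightarrow> 'a" (infixl \<open>\<cdot>\<close> 70)
  assumes linear_left: "Vector_Spaces.linear scale scale (\<lambda>x. x \<cdot> y)"
    and linear_right: "Vector_Spaces.linear scale scale (\<lambda>y. x \<cdot> y)"
    and mult_assoc: "(x \<cdot> y) \<cdot> z = x \<cdot> (y \<cdot> z)"
begin

definition ideal :: "'a set \<Rightarrow> bool" where
  "ideal I \<longleftrightarrow> subspace I \<and> (\<forall>a. \<forall>x\<in>I. a \<cdot> x \<in> I \<and> x \<cdot> a \<in> I)"

text \<open>All bracketings are admitted, so no bracketing convention is fixed. There are no 0-fold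
  products, since the algebra need not be unital.\<close>

inductive nfold_product :: "nat \<Rightarrow> 'a \<Rightarrow> bool" where
  single: "nfold_product 1 x"
| mult: "nfold_product m x \<Longrightarrow> nfold_product k y \<Longrightarrow> nfold_product (m + k) (x \<cdot> y)"

text \<open>The ideal \<open>A\<^sup>n\<close>; it is meaningful for \<open>n \<ge> 1\<close> only.\<close>

definition ideal_power :: "nat \<Rightarrow> 'a set" where
  "ideal_power n = ideal hull {x. nfold_product n x}"

text \<open>Since \<open>A\<^sup>0\<close> is undefined for a non-unital algebra, the condition \<open>A\<^sup>n \<noteq> 0\<close> is imposed for
  \<open>n \<ge> 1\<close>; thus class 0 means precisely that the algebra is zero.\<close>

definition nilpotent_of_class :: "nat \<Rightarrow> bool" where
  "nilpotent_of_class n \<longleftrightarrow> (n \<ge> 1 \<longrightarrow> ideal_power n \<noteq> {0}) \<and> ideal_power (n + 1) = {0}"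

definition nilpotent_of_class_le :: "nat \<Rightarrow> bool" where
  "nilpotent_of_class_le n \<longleftrightarrow> (\<exists>m\<le>n. nilpotent_of_class m)"

lemma ideal_ideal_power: "ideal (ideal_power n)"
  unfolding ideal_power_def
proof (rule hull_in)
  fix S :: "'a set set"
  assume "Ball S ideal"
  then show "ideal (\<Inter>S)"
    by (auto simp: ideal_def subspace_def)
qed

lemma ideal_zero: "ideal {0}"
proof -
  have "a \<cdot> 0 = 0" "0 \<cdot> a = 0" for a
    using module_hom.zero[OF linear_right[unfolded Vector_Spaces.linear_iff_module_hom]]
      module_hom.zero[OF linear_left[unfolded Vector_Spaces.linear_iff_module_hom]]
    by simp_all
  then show ?thesis by (simp add: ideal_def)
qed

lemma ideal_power_eq_zero_iff:
  "ideal_power n = {0} \<longleftrightarrow> (\<forall>x. nfold_product n x \<longrightarrow> x = 0)"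
proof
  assume "ideal_power n = {0}"
  then show "\<forall>x. nfold_product n x \<longrightarrow> x = 0"
    using hull_subset[of "{x. nfold_product n x}" ideal] by (auto simp: ideal_power_def)
next
  assume "\<forall>x. nfold_product n x \<longrightarrow> x = 0"
  then have "ideal_power n \<subseteq> {0}"
    unfolding ideal_power_def by (intro hull_minimal ideal_zero) auto
  moreover have "0 \<in> ideal_power n"
    using ideal_ideal_power[of n] by (simp add: ideal_def subspace_0)
  ultimately show "ideal_power n = {0}" by auto
qed

lemma ideal_power_one: "ideal_power 1 = UNIV"
  using hull_subset[of "{x. nfold_product 1 x}" ideal] nfold_product.single
  by (auto simp: ideal_power_def)

lemma nfold_product_Suc:
  "nfold_product k x \<Longrightarrow> k = Suc (Suc n) \<Longrightarrow> \<exists>a y. nfold_product (Suc n) y \<and> x = a \<cdot> y"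
proof (induction arbitrary: n rule: nfold_product.induct)
  case (single x)
  then show ?case by simp
next
  case (mult m x k y)
  have pos: "nfold_product j z \<Longrightarrow> j \<ge> 1" for j z
    by (induction rule: nfold_product.induct) auto
  have "m \<ge> 1" "k \<ge> 1" using mult.hyps pos by auto
  show ?case
  proof (cases "m = 1")
    case True
    then show ?thesis using mult by auto
  next
    case False
    define m' where "m' = m - 2"
    have m': "m = Suc (Suc m')"
      using False \<open>m \<ge> 1\<close> by (simp add: m'_def)
    obtain a z where az: "nfold_product (Suc m') z" "x = a \<cdot> z"
      using mult.IH(1)[OF m'] by blast
    have "nfold_product (Suc m' + k) (z \<cdot> y)"
      using az(1) mult.hyps by (intro nfold_product.mult)
    moreover have "Suc m' + k = Suc n" using m' mult.prems by simp
    moreover have "x \<cdot> y = a \<cdot> (z \<cdot> y)" by (simp add: az(2) mult_assoc)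
    ultimately show ?thesis by metis
  qed
qed

lemma ideal_power_Suc_zero:
  assumes "ideal_power (Suc n) = {0}"
  shows "ideal_power (Suc (Suc n)) = {0}"
  unfolding ideal_power_eq_zero_iff
proof (intro allI impI)
  fix x assume "nfold_product (Suc (Suc n)) x"
  then obtain a y where "nfold_product (Suc n) y" "x = a \<cdot> y"
    using nfold_product_Suc by blast
  then show "x = 0"
    using assms ideal_zero unfolding ideal_power_eq_zero_iff by (auto simp: ideal_def)
qed

lemma nilpotent_of_class_le_iff:
  "nilpotent_of_class_le n \<longleftrightarrow> (\<forall>x. nfold_product (n + 1) x \<longrightarrow> x = 0)"
proof -
  have up: "ideal_power (n + 1) = {0}" if "ideal_power (m + 1) = {0}" "m \<le> n" for m
    using that(2,1) by (induction rule: dec_induct) (simp_all add: ideal_power_Suc_zero)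
  have down: "nilpotent_of_class_le n" if "ideal_power (n + 1) = {0}"
    using that
  proof (induction n)
    case 0
    then show ?case by (auto simp: nilpotent_of_class_le_def nilpotent_of_class_def)
  next
    case (Suc n)
    show ?case
    proof (cases "ideal_power (n + 1) = {0}")
      case True
      then show ?thesis
        using Suc.IH unfolding nilpotent_of_class_le_def by (meson le_Suc_eq)
    next
      case False
      then show ?thesis
        using Suc.prems by (auto simp: nilpotent_of_class_le_def nilpotent_of_class_def)
    qed
  qed
  show ?thesis
    unfolding ideal_power_eq_zero_iff[symmetric]
    using up down by (auto simp: nilpotent_of_class_le_def nilpotent_of_class_def)
qed

end

locale triassociative_algebra = vector_space scale
  for scale :: "'k::field \<Rightarrow> 'a::ab_group_add \<Rightarrow> 'a" (infixr \<open>*s\<close> 75) +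
  fixes left :: "'a \<Rightarrow> 'a \<Rightarrow> 'a" (infixl \<open>\<turnstile>\<close> 70)
    and right :: "'a \<Rightarrow> 'a \<Rightarrow> 'a" (infixl \<open>\<stileturn>\<close> 70)
    and perp :: "'a \<Rightarrow> 'a \<Rightarrow> 'a" (infixl \<open>\<bottom>\<close> 70)
  assumes left_linear_left: "Vector_Spaces.linear scale scale (\<lambda>x. x \<turnstile> y)"
    and left_linear_right: "Vector_Spaces.linear scale scale (\<lambda>y. x \<turnstile> y)"
    and right_linear_left: "Vector_Spaces.linear scale scale (\<lambda>x. x \<stileturn> y)"
    and right_linear_right: "Vector_Spaces.linear scale scale (\<lambda>y. x \<stileturn> y)"
    and perp_linear_left: "Vector_Spaces.linear scale scale (\<lambda>x. x \<bottom> y)"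
    and perp_linear_right: "Vector_Spaces.linear scale scale (\<lambda>y. x \<bottom> y)"
    and A1: "(x \<turnstile> y) \<turnstile> z = x \<turnstile> (y \<turnstile> z)"
    and A2: "(x \<stileturn> y) \<stileturn> z = x \<stileturn> (y \<stileturn> z)"
    and D1: "(x \<stileturn> y) \<turnstile> z = x \<turnstile> (y \<turnstile> z)"
    and D2: "(x \<stileturn> y) \<stileturn> z = x \<stileturn> (y \<turnstile> z)"
    and S1: "(x \<turnstile> y) \<stileturn> z = x \<turnstile> (y \<stileturn> z)"
    and T1: "(x \<bottom> y) \<turnstile> z = x \<turnstile> (y \<turnstile> z)"
    and T2: "(x \<stileturn> y) \<stileturn> z = x \<stileturn> (y \<bottom> z)"
    and T3: "(x \<turnstile> y) \<bottom> z = x \<turnstile> (y \<bottom> z)"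
    and T4: "(x \<bottom> y) \<stileturn> z = x \<bottom> (y \<stileturn> z)"
    and S2: "(x \<stileturn> y) \<bottom> z = x \<bottom> (y \<turnstile> z)"
    and A3: "(x \<bottom> y) \<bottom> z = x \<bottom> (y \<bottom> z)"
begin

sublocale left: associative_algebra scale left
  by (intro associative_algebra.intro associative_algebra_axioms.intro vector_space_axioms
      left_linear_left left_linear_right A1)

sublocale right: associative_algebra scale right
  by (intro associative_algebra.intro associative_algebra_axioms.intro vector_space_axioms
      right_linear_left right_linear_right A2)

sublocale perp: associative_algebra scale perp
  by (intro associative_algebra.intro associative_algebra_axioms.intro vector_space_axioms
      perp_linear_left perp_linear_right A3)

end

end

theory Submission
  imports Defs
begin

text \<open>The map \<open>x \<mapsto> (x \<turnstile> _)\<close> turns each product into composition of operators: by (A1)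
  \<open>x \<turnstile> y\<close>, and by (T1) also \<open>x \<bottom> y\<close>, acts as \<open>z \<mapsto> x \<turnstile> (y \<turnstile> z)\<close>. As a left \<open>\<turnstile>\<close>-factor,
  an \<open>m\<close>-fold \<open>\<turnstile>\<close>-product may therefore be replaced by an \<open>m\<close>-fold \<open>\<bottom>\<close>-product
  (\<open>left_product_acts_as_perp_product\<close>). An \<open>(n + 2)\<close>-fold \<open>\<turnstile>\<close>-product is, after rebracketing,
  \<open>y \<turnstile> b\<close> for an \<open>(n + 1)\<close>-fold product \<open>y\<close>, so it equals \<open>p \<turnstile> b\<close> for an \<open>(n + 1)\<close>-fold
  \<open>\<bottom>\<close>-product \<open>p\<close>. If \<open>(T, \<bottom>)\<close> has class \<open>n\<close>, then \<open>p = 0\<close>. The one extra factor \<open>b\<close>, on which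
  the operators act, is what raises the bound from \<open>n\<close> to \<open>n + 1\<close>. For \<open>\<stileturn>\<close> the argument is the mirror
  image, with right multiplication and (A2), (T2) instead.\<close>

context associative_algebra
begin

text \<open>Counterpart of \<open>nfold_product_Suc\<close>, which splits off a factor on the left; here the
  multiplication operators act from the left, so their argument has to be the last factor.\<close>

lemma nfold_product_split_last:
  assumes "nfold_product k x" and "k = Suc (Suc n)"
  shows "\<exists>y b. nfold_product (Suc n) y \<and> x = y \<cdot> b"
  using assms
proof (induction arbitrary: n rule: nfold_product.induct)
  case (single x)
  then show ?case by simp
next
  case (mult m x k y)
  have pos: "nfold_product j z \<Longrightarrow> j \<ge> 1" for j z
    by (induction rule: nfold_product.induct) auto
  have "m \<ge> 1" "k \<ge> 1" using mult.hyps pos by auto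
  show ?case
  proof (cases "k = 1")
    case True
    then show ?thesis using mult by auto
  next
    case False
    then obtain k' where k': "k = Suc (Suc k')"
      using \<open>k \<ge> 1\<close> by (cases k rule: nat.exhaust; cases "k - 1") auto
    then obtain z b where zb: "nfold_product (Suc k') z" "y = z \<cdot> b"
      using mult.IH(2) by blast
    have "nfold_product (m + Suc k') (x \<cdot> z)"
      using zb(1) mult.hyps by (intro nfold_product.mult)
    moreover have "m + Suc k' = Suc n" using k' mult.prems by simp
    moreover have "x \<cdot> y = (x \<cdot> z) \<cdot> b" by (simp add: zb(2) mult_assoc)
    ultimately show ?thesis by auto
  qed
qed

lemma mult_zero: "0 \<cdot> x = 0" "x \<cdot> 0 = 0"
  using ideal_zero by (auto simp: ideal_def)

end

context triassociative_algebra
begin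

text \<open>Under \<open>x \<mapsto> (x \<turnstile> _)\<close> the products \<open>\<turnstile>\<close> and \<open>\<bottom>\<close> have the same image, by (A1) and (T1); so
  replacing every \<open>\<turnstile>\<close> in a product by \<open>\<bottom>\<close> does not change the operator.\<close>

lemma left_product_acts_as_perp_product:
  assumes "left.nfold_product m x"
  shows "\<exists>p. perp.nfold_product m p \<and> (\<forall>z. x \<turnstile> z = p \<turnstile> z)"
  using assms
proof (induction rule: left.nfold_product.induct)
  case (single x)
  then show ?case using perp.nfold_product.single by blast
next
  case (mult m x k y)
  then obtain p q where
    "perp.nfold_product m p" "\<forall>z. x \<turnstile> z = p \<turnstile> z"
    "perp.nfold_product k q" "\<forall>z. y \<turnstile> z = q \<turnstile> z"
    by blast
  then have "perp.nfold_product (m + k) (p \<bottom> q)" "\<forall>z. (x \<turnstile> y) \<turnstile> z = (p \<bottom> q) \<turnstile> z"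
    by (auto simp: A1 T1 intro: perp.nfold_product.mult)
  then show ?case by blast
qed

lemma right_product_acts_as_perp_product:
  assumes "right.nfold_product m x"
  shows "\<exists>p. perp.nfold_product m p \<and> (\<forall>z. z \<stileturn> x = z \<stileturn> p)"
  using assms
proof (induction rule: right.nfold_product.induct)
  case (single x)
  then show ?case using perp.nfold_product.single by blast
next
  case (mult m x k y)
  then obtain p q where pq:
    "perp.nfold_product m p" "\<And>z. z \<stileturn> x = z \<stileturn> p"
    "perp.nfold_product k q" "\<And>z. z \<stileturn> y = z \<stileturn> q"
    by blast
  have "z \<stileturn> (x \<stileturn> y) = z \<stileturn> (p \<bottom> q)" for z
    by (simp add: A2[symmetric] T2[symmetric] pq(2,4))
  then show ?case using pq(1,3) perp.nfold_product.mult by blast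
qed

lemma nilpotent_of_class_le_left_right:
  assumes "perp.nilpotent_of_class_le n"
  shows "left.nilpotent_of_class_le (n + 1)" "right.nilpotent_of_class_le (n + 1)"
proof -
  have perp_zero: "p = 0" if "perp.nfold_product (Suc n) p" for p
    using assms that by (simp add: perp.nilpotent_of_class_le_iff)
  show "left.nilpotent_of_class_le (n + 1)"
    unfolding left.nilpotent_of_class_le_iff
  proof (intro allI impI)
    fix x assume "left.nfold_product (n + 1 + 1) x"
    then obtain y b where "left.nfold_product (Suc n) y" "x = y \<turnstile> b"
      using left.nfold_product_split_last[of "n + 1 + 1" x n] by auto
    moreover then obtain p where "perp.nfold_product (Suc n) p" "y \<turnstile> b = p \<turnstile> b"
      using left_product_acts_as_perp_product by blast
    moreover from this have "p = 0" by (intro perp_zero)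
    ultimately show "x = 0" by (simp add: left.mult_zero)
  qed
  show "right.nilpotent_of_class_le (n + 1)"
    unfolding right.nilpotent_of_class_le_iff
  proof (intro allI impI)
    fix x assume "right.nfold_product (n + 1 + 1) x"
    then obtain a y where "right.nfold_product (Suc n) y" "x = a \<stileturn> y"
      using right.nfold_product_Suc[of "n + 1 + 1" x n] by auto
    moreover then obtain p where "perp.nfold_product (Suc n) p" "a \<stileturn> y = a \<stileturn> p"
      using right_product_acts_as_perp_product by blast
    moreover from this have "p = 0" by (intro perp_zero)
    ultimately show "x = 0" by (simp add: right.mult_zero)
  qed
qed

end

theorem theorem4p3:
  fixes scale :: "'k::field \<Rightarrow> 'a::ab_group_add \<Rightarrow> 'a"
    and left right perp :: "'a \<Rightarrow> 'a \<Rightarrow> 'a"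
    and n :: nat
  assumes "triassociative_algebra scale left right perp"
    and "associative_algebra.nilpotent_of_class scale perp n"
  shows "associative_algebra.nilpotent_of_class_le scale left (n + 1) \<and>
         associative_algebra.nilpotent_of_class_le scale right (n + 1)"
proof -
  interpret triassociative_algebra scale left right perp by (fact assms(1))
  have "perp.nilpotent_of_class_le n"
    using assms(2) by (auto simp: perp.nilpotent_of_class_le_def)
  then show ?thesis
    using nilpotent_of_class_le_left_right by blast
qed

end
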